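(* Let $A,B\in\mathbb{R}$ (the case $n=m=1$), let $0<\mu<\sigma$, and let $\{\bar Q_t\}_{t\ge1}$, $\{\bar R_t\}_{t\ge1}$ be sequences of real numbers in $[\mu,\sigma]$. Let $\{P_t\}_{t\ge1}$ be a sequence of positive numbers generated recursively, starting from an initial stable $K_1\in\mathbb{R}$, by $$P_t=(A-BK_t)^2P_t+\bar Q_t+K_t^2\bar R_t,\qquad K_{t+1}=(B^2P_t+\bar R_t)^{-1}BP_tA,\qquad t\ge1,$$ and assume that $K_t$ is stable for all $t\ge1$. Then there exists $\nu>0$ such that $P_t\le\nu$ for all $t\ge1$.
   Context: In the scalar case, a policy $K\in\mathbb{R}$ is called stable if $|A-BK|<1$. *)

theory Defs
  imports Complex_Main
begin

definition stable_policy :: "real \<Rightarrow> real \<Rightarrow> real \<Rightarrow> bool" where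
  "stable_policy A B K \<longleftrightarrow> \<bar>A - B * K\<bar> < 1"

end

theory Submission
  imports Defs
begin

text \<open>
  Write \<open>l = A - B K\<^sub>t\<close> for the closed-loop coefficient. Since
  \<open>P\<^sub>t (1 - l\<^sup>2) = Q\<^sub>t + K\<^sub>t\<^sup>2 R\<^sub>t\<close>, and both \<open>Q\<^sub>t\<close> and the \<open>K\<^sub>t\<close> with \<open>t \<ge> 2\<close> are bounded,
  \<open>P\<^sub>t\<close> can only blow up if \<open>\<bar>l\<bar>\<close> comes close to \<open>1\<close>. Improving the policy prevents this:
  the updated coefficient is \<open>A R\<^sub>t / (B\<^sup>2 P\<^sub>t + R\<^sub>t)\<close>, and the \<open>R\<^sub>t\<close> occurring here is the one
  that defines \<open>P\<^sub>t\<close>. Because the two match, \<open>B\<^sup>2 P\<^sub>t / R\<^sub>t\<close> is bounded below by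
  \<open>A\<^sup>2 - 1 + B\<^sup>2 \<mu> / \<sigma>\<close> whatever the stable gain \<open>K\<^sub>t\<close> is (lemma \<open>cost_ge\<close>), so every
  updated coefficient is at most
  \<open>\<bar>A\<bar> / max 1 (A\<^sup>2 + B\<^sup>2 \<mu> / \<sigma>)\<close> in absolute value (lemma \<open>improved_loop_le\<close>).
  This constant is less than \<open>1\<close> and does not depend on \<open>t\<close>.
\<close>

text \<open>
  Without state penalty (\<open>\<rho> = 0\<close>) this bounds the minimal cost, in units of \<open>R / B\<^sup>2\<close>:
  \<open>(A - l)\<^sup>2 / (1 - l\<^sup>2)\<close> has minimum \<open>A\<^sup>2 - 1\<close> on \<open>\<bar>l\<bar> < 1\<close> when \<open>\<bar>A\<bar> > 1\<close>, attained at
  \<open>l = 1 / A\<close>. The identity \<open>(A - l)\<^sup>2 - (A\<^sup>2 - 1) (1 - l\<^sup>2) = (1 - A l)\<^sup>2\<close> proves it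
  for all \<open>A\<close>. The state penalty contributes \<open>\<rho> * B\<^sup>2\<close>.
\<close>

lemma cost_ge:
  fixes A B K P Q R \<rho> :: real
  assumes stable: "stable_policy A B K"
    and eq: "P = (A - B * K)\<^sup>2 * P + Q + K\<^sup>2 * R"
    and "0 \<le> \<rho>" "0 \<le> R" "\<rho> * R \<le> Q"
  shows "(A\<^sup>2 - 1 + \<rho> * B\<^sup>2) * R \<le> B\<^sup>2 * P"
proof -
  define l where "l = A - B * K"
  have l: "l\<^sup>2 < 1"
    using stable by (simp add: stable_policy_def l_def abs_square_less_1)
  have BK: "B * K = A - l"
    by (simp add: l_def)
  have \<section>: "P * (1 - l\<^sup>2) = Q + K\<^sup>2 * R"
    using eq by (simp add: l_def algebra_simps)
  have "(A - l)\<^sup>2 - (A\<^sup>2 - 1) * (1 - l\<^sup>2) = (1 - A * l)\<^sup>2"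
    by (simp add: power2_eq_square algebra_simps)
  then have sq: "(A\<^sup>2 - 1) * (1 - l\<^sup>2) \<le> (A - l)\<^sup>2"
    by (metis diff_ge_0_iff_ge zero_le_power2)
  have "\<rho> * B\<^sup>2 * (1 - l\<^sup>2) \<le> \<rho> * B\<^sup>2"
    using \<open>0 \<le> \<rho>\<close> by (simp add: mult_left_le)
  with sq have "(A\<^sup>2 - 1 + \<rho> * B\<^sup>2) * (1 - l\<^sup>2) \<le> (A - l)\<^sup>2 + \<rho> * B\<^sup>2"
    by (simp add: distrib_right)
  then have "(A\<^sup>2 - 1 + \<rho> * B\<^sup>2) * (1 - l\<^sup>2) * R \<le> ((A - l)\<^sup>2 + \<rho> * B\<^sup>2) * R"
    using \<open>0 \<le> R\<close> by (rule mult_right_mono)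
  also have "\<dots> = (B * K)\<^sup>2 * R + B\<^sup>2 * (\<rho> * R)"
    by (simp add: BK algebra_simps)
  also have "\<dots> \<le> (B * K)\<^sup>2 * R + B\<^sup>2 * Q"
    using \<open>\<rho> * R \<le> Q\<close> by (simp add: mult_left_mono)
  also have "\<dots> = B\<^sup>2 * (P * (1 - l\<^sup>2))"
    unfolding \<section> by (simp add: power_mult_distrib algebra_simps)
  finally have "((A\<^sup>2 - 1 + \<rho> * B\<^sup>2) * R) * (1 - l\<^sup>2) \<le> (B\<^sup>2 * P) * (1 - l\<^sup>2)"
    by (simp add: mult_ac)
  then show ?thesis
    using l by simp
qed

lemma improved_loop_eq:
  fixes A B P R :: real
  assumes "0 < P" "0 < R"
  shows "A - B * (inverse (B\<^sup>2 * P + R) * B * P * A) = A * R / (B\<^sup>2 * P + R)"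
proof -
  have "B\<^sup>2 * P + R > 0"
    using assms by (simp add: add_nonneg_pos)
  then show ?thesis
    by (simp add: field_simps power2_eq_square)
qed

lemma improved_loop_le:
  fixes A B K P Q R \<rho> :: real
  assumes "stable_policy A B K"
    and "P = (A - B * K)\<^sup>2 * P + Q + K\<^sup>2 * R"
    and "0 \<le> \<rho>" "0 < R" "\<rho> * R \<le> Q" "0 < P"
  shows "\<bar>A - B * (inverse (B\<^sup>2 * P + R) * B * P * A)\<bar> \<le> \<bar>A\<bar> / max 1 (A\<^sup>2 + \<rho> * B\<^sup>2)"
proof -
  let ?m = "max 1 (A\<^sup>2 + \<rho> * B\<^sup>2)"
  have pos: "B\<^sup>2 * P + R > 0"
    using assms by (simp add: add_nonneg_pos)
  have "(A\<^sup>2 - 1 + \<rho> * B\<^sup>2) * R \<le> B\<^sup>2 * P"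
    using assms by (intro cost_ge) auto
  moreover have "0 \<le> B\<^sup>2 * P"
    using assms by simp
  ultimately have "?m * R \<le> B\<^sup>2 * P + R"
    by (auto simp: max_def algebra_simps)
  then have "\<bar>A\<bar> * (?m * R) \<le> \<bar>A\<bar> * (B\<^sup>2 * P + R)"
    by (rule mult_left_mono) simp
  then have "\<bar>A\<bar> * R / (B\<^sup>2 * P + R) \<le> \<bar>A\<bar> / ?m"
    using pos by (simp add: divide_le_eq le_divide_eq mult_ac less_max_iff_disj)
  then show ?thesis
    using assms pos by (simp add: improved_loop_eq abs_mult)
qed

text \<open>For \<open>B = 0\<close> both sides vanish, as \<open>A / 0 = 0\<close>, so no case distinction is needed later.\<close>

lemma improved_gain_le:
  fixes A B P R :: real
  assumes "0 < P" "0 < R"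
  shows "\<bar>inverse (B\<^sup>2 * P + R) * B * P * A\<bar> \<le> \<bar>A / B\<bar>"
proof (cases "B = 0")
  case False
  have pos: "B\<^sup>2 * P + R > 0"
    using assms by (simp add: add_nonneg_pos)
  have "inverse (B\<^sup>2 * P + R) * B * P * A = (B\<^sup>2 * P / (B\<^sup>2 * P + R)) * (A / B)"
    using False by (simp add: field_simps power2_eq_square)
  moreover have "\<bar>B\<^sup>2 * P / (B\<^sup>2 * P + R)\<bar> \<le> 1"
    using assms pos by (simp add: abs_mult)
  ultimately show ?thesis
    by (simp only: abs_mult) (intro mult_left_le_one_le; simp)
qed simp

text \<open>
  If \<open>B \<noteq> 0\<close>, the bound is less than \<open>1\<close> even for unstable \<open>A\<close>, because
  \<open>\<bar>A\<bar> \<le> max 1 (A\<^sup>2)\<close> and \<open>\<rho> * B\<^sup>2\<close> makes this strict where \<open>\<bar>A\<bar> \<ge> 1\<close>. If \<open>B = 0\<close>,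
  a stable policy exists only when \<open>\<bar>A\<bar> < 1\<close>.
\<close>

lemma loop_bound_less_1:
  fixes A B K \<rho> :: real
  assumes "stable_policy A B K" "0 < \<rho>"
  shows "\<bar>A\<bar> / max 1 (A\<^sup>2 + \<rho> * B\<^sup>2) < 1"
proof -
  have "\<bar>A\<bar> < max 1 (A\<^sup>2 + \<rho> * B\<^sup>2)"
  proof (cases "\<bar>A\<bar> < 1")
    case False
    then have "B \<noteq> 0"
      using assms by (auto simp: stable_policy_def)
    then have "\<rho> * B\<^sup>2 > 0"
      using assms by simp
    moreover have "\<bar>A\<bar> * 1 \<le> \<bar>A\<bar> * \<bar>A\<bar>"
      using False by (intro mult_left_mono) auto
    ultimately show ?thesis
      by (simp add: power2_eq_square less_max_iff_disj)
  qed (simp add: less_max_iff_disj)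
  then show ?thesis
    by (simp add: divide_less_eq less_max_iff_disj)
qed

theorem propositionA1:
  fixes A B \<mu> \<sigma> :: real
    and Q R P K :: "nat \<Rightarrow> real"
  assumes "0 < \<mu>" and "\<mu> < \<sigma>"
    and "\<And>t. t \<ge> 1 \<Longrightarrow> Q t \<in> {\<mu>..\<sigma>}"
    and "\<And>t. t \<ge> 1 \<Longrightarrow> R t \<in> {\<mu>..\<sigma>}"
    and "\<And>t. t \<ge> 1 \<Longrightarrow> P t > 0"
    and "stable_policy A B (K 1)"
    and "\<And>t. t \<ge> 1 \<Longrightarrow> P t = (A - B * K t)\<^sup>2 * P t + Q t + (K t)\<^sup>2 * R t"
    and "\<And>t. t \<ge> 1 \<Longrightarrow> K (t + 1) = inverse (B\<^sup>2 * P t + R t) * B * P t * A"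
    and "\<And>t. t \<ge> 1 \<Longrightarrow> stable_policy A B (K t)"
  shows "\<exists>\<nu>>0. \<forall>t\<ge>1. P t \<le> \<nu>"
proof -
  define \<rho> where "\<rho> = \<mu> / \<sigma>"
  define q where "q = \<bar>A\<bar> / max 1 (A\<^sup>2 + \<rho> * B\<^sup>2)"
  define c where "c = \<sigma> * (1 + (A / B)\<^sup>2)"
  have \<rho>: "0 < \<rho>"
    using assms(1,2) by (simp add: \<rho>_def)
  have "0 \<le> q"
    by (simp add: q_def)
  moreover have "q < 1"
    unfolding q_def using assms(6) \<rho> by (rule loop_bound_less_1)
  ultimately have q: "q\<^sup>2 < 1"
    by (simp add: abs_square_less_1)
  have step: "P (t + 1) \<le> c / (1 - q\<^sup>2)" if t: "t \<ge> 1" for t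
  proof -
    have Rt: "0 < R t"
      using assms(1) assms(4)[OF t] by simp
    have "\<mu> * R t \<le> \<mu> * \<sigma>"
      using assms(1) assms(4)[OF t] by simp
    also have "\<dots> \<le> Q t * \<sigma>"
      using assms(1,2) assms(3)[OF t] by simp
    finally have "\<rho> * R t \<le> Q t"
      using assms(1,2) by (simp add: \<rho>_def divide_le_eq)
    then have "\<bar>A - B * K (t + 1)\<bar> \<le> q"
      unfolding assms(8)[OF t] q_def
      using assms(9)[OF t] assms(7)[OF t] \<rho> Rt assms(5)[OF t]
      by (intro improved_loop_le) auto
    then have L: "(A - B * K (t + 1))\<^sup>2 \<le> q\<^sup>2"
      by (metis abs_ge_zero power2_abs power_mono)
    have "\<bar>K (t + 1)\<bar> \<le> \<bar>A / B\<bar>"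
      unfolding assms(8)[OF t] using assms(5)[OF t] Rt by (rule improved_gain_le)
    then have "(K (t + 1))\<^sup>2 \<le> (A / B)\<^sup>2"
      by (simp only: abs_le_square_iff)
    then have "(K (t + 1))\<^sup>2 * R (t + 1) \<le> (A / B)\<^sup>2 * \<sigma>"
      using assms(1) assms(4)[of "t + 1"] by (intro mult_mono) auto
    moreover have "Q (t + 1) \<le> \<sigma>"
      using assms(3)[of "t + 1"] by simp
    moreover have "(A - B * K (t + 1))\<^sup>2 * P (t + 1) \<le> q\<^sup>2 * P (t + 1)"
      using L assms(5)[of "t + 1"] by (intro mult_right_mono) auto
    ultimately have "P (t + 1) * (1 - q\<^sup>2) \<le> c"
      using assms(7)[of "t + 1"] by (simp add: c_def algebra_simps)
    then show ?thesis
      using q by (simp add: le_divide_eq)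
  qed
  \<comment> \<open>The initial gain does not come from an update, so \<open>P 1\<close> enters the bound separately.\<close>
  have "P t \<le> max (P 1) (c / (1 - q\<^sup>2))" if "t \<ge> 1" for t
  proof (cases "t = 1")
    case False
    with that have "t - 1 \<ge> 1" "t - 1 + 1 = t"
      by auto
    with step[of "t - 1"] show ?thesis
      by simp
  qed simp
  moreover have "0 < max (P 1) (c / (1 - q\<^sup>2))"
    using assms(5)[of 1] by (simp add: less_max_iff_disj)
  ultimately show ?thesis
    by blast
qed

end
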